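(* Let $f\colon\mathbf{R}\to\mathbf{R}$ be a function defined on the whole real line. (a) If $f$ is $2$-monotone and three times continuously differentiable, then $f$ is affine. (b) If $f$ is $2$-convex and four times continuously differentiable, then $f$ is quadratic, that is, a polynomial of degree at most two.
   Context: Let $f$ be a real function defined in an interval $I\subseteq\mathbf{R}$ and let $n$ be a natural number. For a Hermitian $n\times n$ matrix $A$ with spectrum in $I$, $f(A)$ is defined by the functional calculus (apply $f$ to the eigenvalues in a spectral decomposition), and $A\le B$ means that $B-A$ is positive semi-definite. The function $f$ is called $n$-monotone if $A\le B$ implies $f(A)\le f(B)$ for arbitrary Hermitian $n\times n$ matrices $A,B$ with spectra in $I$. It is called $n$-convex if $f(\lambda A+(1-\lambda)B)\le\lambda f(A)+(1-\lambda)f(B)$ for all $\lambda\in[0,1]$ and arbitrary Hermitian $n\times n$ matrices $A,B$ with spectra in $I$. *)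

theory Defs
  imports "Jordan_Normal_Form.Schur_Decomposition" "Jordan_Normal_Form.Spectral_Radius"
begin

definition hermitian_mat :: "nat \<Rightarrow> complex mat \<Rightarrow> bool" where
  "hermitian_mat n A \<longleftrightarrow> A \<in> carrier_mat n n \<and> mat_adjoint A = A"

definition unitary_mat :: "nat \<Rightarrow> complex mat \<Rightarrow> bool" where
  "unitary_mat n U \<longleftrightarrow>
     U \<in> carrier_mat n n \<and> mat_adjoint U * U = 1\<^sub>m n \<and> U * mat_adjoint U = 1\<^sub>m n"

text \<open>The order on complex numbers is the one where \<open>0 \<le> z\<close> means that \<open>z\<close> is real
  and nonnegative.\<close>

definition psd_mat :: "nat \<Rightarrow> complex mat \<Rightarrow> bool" where
  "psd_mat n A \<longleftrightarrow> hermitian_mat n A \<and> (\<forall>v \<in> carrier_vec n. 0 \<le> (A *\<^sub>v v) \<bullet>c v)"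

definition loewner_le :: "nat \<Rightarrow> complex mat \<Rightarrow> complex mat \<Rightarrow> bool" where
  "loewner_le n A B \<longleftrightarrow> psd_mat n (B - A)"

definition spectral_decomposition ::
  "nat \<Rightarrow> complex mat \<Rightarrow> complex mat \<Rightarrow> (nat \<Rightarrow> real) \<Rightarrow> bool" where
  "spectral_decomposition n A U d \<longleftrightarrow>
     unitary_mat n U \<and> A = U * mat_diag n (\<lambda>i. complex_of_real (d i)) * mat_adjoint U"

text \<open>Only meaningful for Hermitian \<open>A\<close>, which have a spectral decomposition by the
  spectral theorem; by \<open>mat_fun_eqI\<close> below the result does not depend on the choice of
  that decomposition.\<close>

definition mat_fun :: "nat \<Rightarrow> (real \<Rightarrow> real) \<Rightarrow> complex mat \<Rightarrow> complex mat" where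
  "mat_fun n f A =
     (THE B. \<exists>U d. spectral_decomposition n A U d \<and>
        B = U * mat_diag n (\<lambda>i. complex_of_real (f (d i))) * mat_adjoint U)"

definition hermitian_mats_in :: "nat \<Rightarrow> real set \<Rightarrow> complex mat set" where
  "hermitian_mats_in n I = {A. hermitian_mat n A \<and> spectrum A \<subseteq> complex_of_real ` I}"

text \<open>Here and in the next definition \<open>I\<close> is meant to be an interval; only the values
  of \<open>f\<close> on \<open>I\<close> matter.\<close>

definition n_monotone :: "nat \<Rightarrow> real set \<Rightarrow> (real \<Rightarrow> real) \<Rightarrow> bool" where
  "n_monotone n I f \<longleftrightarrow>
     (\<forall>A \<in> hermitian_mats_in n I. \<forall>B \<in> hermitian_mats_in n I.
        loewner_le n A B \<longrightarrow> loewner_le n (mat_fun n f A) (mat_fun n f B))"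

definition n_convex :: "nat \<Rightarrow> real set \<Rightarrow> (real \<Rightarrow> real) \<Rightarrow> bool" where
  "n_convex n I f \<longleftrightarrow>
     (\<forall>A \<in> hermitian_mats_in n I. \<forall>B \<in> hermitian_mats_in n I. \<forall>t \<in> {0..1::real}.
        loewner_le n
          (mat_fun n f (complex_of_real t \<cdot>\<^sub>m A + complex_of_real (1 - t) \<cdot>\<^sub>m B))
          (complex_of_real t \<cdot>\<^sub>m mat_fun n f A + complex_of_real (1 - t) \<cdot>\<^sub>m mat_fun n f B))"

text \<open>\<open>k\<close> times continuously differentiable on the whole real line; \<open>D j\<close> is the
  \<open>j\<close>-th derivative of \<open>f\<close>.\<close>

definition times_cont_differentiable :: "nat \<Rightarrow> (real \<Rightarrow> real) \<Rightarrow> bool" where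
  "times_cont_differentiable k f \<longleftrightarrow>
     (\<exists>D :: nat \<Rightarrow> real \<Rightarrow> real. D 0 = f \<and>
        (\<forall>j < k. \<forall>x. (D j has_real_derivative D (Suc j) x) (at x)) \<and>
        continuous_on UNIV (D k))"

lemma mat_adjoint_carrier:
  "A \<in> carrier_mat n m \<Longrightarrow> mat_adjoint (A :: complex mat) \<in> carrier_mat m n"
  unfolding mat_adjoint_def by (auto intro!: carrier_matI)

lemma spectral_decomposition_fun_unique:
  assumes "spectral_decomposition n A U d" "spectral_decomposition n A V e"
  shows "U * mat_diag n (\<lambda>i. complex_of_real (f (d i))) * mat_adjoint U =
         V * mat_diag n (\<lambda>i. complex_of_real (f (e i))) * mat_adjoint V"
proof -
  define U' V' where "U' = mat_adjoint U" and "V' = mat_adjoint V"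
  define D where "D d = mat_diag n (\<lambda>i. complex_of_real (d i))" for d :: "nat \<Rightarrow> real"
  have c [simp]: "U \<in> carrier_mat n n" "V \<in> carrier_mat n n" "U' \<in> carrier_mat n n"
    "V' \<in> carrier_mat n n" "D g \<in> carrier_mat n n" for g
    using assms unfolding spectral_decomposition_def unitary_mat_def U'_def V'_def D_def
    by (auto intro: mat_adjoint_carrier)
  have inv: "U' * U = 1\<^sub>m n" "U * U' = 1\<^sub>m n" "V' * V = 1\<^sub>m n" "V * V' = 1\<^sub>m n"
    and eq: "U * D d * U' = V * D e * V'"
    using assms unfolding spectral_decomposition_def unitary_mat_def U'_def V'_def D_def
    by auto
  define W where "W = V' * U"
  have cW [simp]: "W \<in> carrier_mat n n" unfolding W_def by (rule mult_carrier_mat[of _ _ n]) auto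
  note assoc = assoc_mult_mat[of _ n n _ n _ n]
  have m: "X * Y \<in> carrier_mat n n" if "X \<in> carrier_mat n n" "Y \<in> carrier_mat n n"
    for X Y :: "complex mat" using that by (rule mult_carrier_mat)
  have one: "X * 1\<^sub>m n = X" "1\<^sub>m n * X = X" if "X \<in> carrier_mat n n" for X :: "complex mat"
    using that by auto
  have cancel: "V' * (V * X) = X" "V * (V' * X) = X" "U' * (U * X) = X" "U * (U' * X) = X"
    if "X \<in> carrier_mat n n" for X
    using that by (simp_all flip: assoc add: inv one)
  have "W * D d = V' * (U * D d * U') * U"
    by (simp add: W_def assoc inv m one)
  also have "\<dots> = D e * W"
    unfolding eq by (simp add: W_def assoc m cancel)
  finally have WD: "W * D d = D e * W" .
  have ent: "W $$ (i,j) * complex_of_real (d j) = complex_of_real (e i) * W $$ (i,j)"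
    if "i < n" "j < n" for i j
  proof -
    have "(W * D d) $$ (i,j) = (D e * W) $$ (i,j)" by (simp add: WD)
    thus ?thesis using that by (simp add: D_def mat_diag_mult_left[OF cW] mat_diag_mult_right[OF cW])
  qed
  have WF: "W * D (\<lambda>i. f (d i)) = D (\<lambda>i. f (e i)) * W"
  proof (rule eq_matI)
    fix i j assume "i < dim_row (D (\<lambda>i. f (e i)) * W)" "j < dim_col (D (\<lambda>i. f (e i)) * W)"
    hence ij: "i < n" "j < n" using carrier_matD[OF m[OF c(5) cW]] by simp_all
    have "W $$ (i,j) * complex_of_real (f (d j)) = complex_of_real (f (e i)) * W $$ (i,j)"
      using ent[OF ij] by (cases "W $$ (i,j) = 0") (auto simp: mult.commute)
    thus "(W * D (\<lambda>i. f (d i))) $$ (i, j) = (D (\<lambda>i. f (e i)) * W) $$ (i, j)"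
      using ij by (simp add: D_def mat_diag_mult_left[OF cW] mat_diag_mult_right[OF cW])
  qed (simp_all only: carrier_matD[OF m[OF c(5) cW]] carrier_matD[OF m[OF cW c(5)]])
  have "U * D (\<lambda>i. f (d i)) * U' = V * (W * D (\<lambda>i. f (d i))) * U'"
    by (simp add: W_def assoc m cancel)
  also have "\<dots> = V * D (\<lambda>i. f (e i)) * V'"
    unfolding WF by (simp add: W_def assoc m inv one)
  finally show ?thesis by (simp add: D_def U'_def V'_def)
qed

lemma mat_fun_eqI:
  assumes "spectral_decomposition n A U d"
  shows "mat_fun n f A = U * mat_diag n (\<lambda>i. complex_of_real (f (d i))) * mat_adjoint U"
  unfolding mat_fun_def
proof (rule the_equality)
  show "\<exists>V e. spectral_decomposition n A V e \<and>
      U * mat_diag n (\<lambda>i. complex_of_real (f (d i))) * mat_adjoint U =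
      V * mat_diag n (\<lambda>i. complex_of_real (f (e i))) * mat_adjoint V"
    using assms by blast
next
  fix B
  assume "\<exists>V e. spectral_decomposition n A V e \<and>
      B = V * mat_diag n (\<lambda>i. complex_of_real (f (e i))) * mat_adjoint V"
  thus "B = U * mat_diag n (\<lambda>i. complex_of_real (f (d i))) * mat_adjoint U"
    using spectral_decomposition_fun_unique[OF _ assms, where f = f] by metis
qed

end

theory Submission
  imports Defs
begin

text \<open>Both parts need only \<open>2 \<times> 2\<close> matrices whose eigenvectors are known explicitly. Write
  \<open>f[\<dots>]\<close> for divided differences.

  (a) For \<open>a < x < b < y\<close> rotate \<open>diag(a, b)\<close> as far as it stays below \<open>diag(x, y)\<close>. The determinant
  condition for the images under \<open>f\<close> is \<open>f[a,b] f[x,y] \<le> f[a,x] f[b,y]\<close>. Letting \<open>a\<close> tend to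
  \<open>-\<infinity>\<close> gives \<open>f[x,y] \<le> f[b,y]\<close>, so \<open>f\<close> is convex; reflecting the line shows that it is concave.

  (b) Fix \<open>p < q < r\<close>. Two matrices with eigenvalues \<open>r, y\<close> and \<open>p, y\<close> and with slightly rotated
  eigenvectors can be mixed into a diagonal one; as the rotation tends to zero, convexity yields a
  Riccati inequality \<open>K\<^sup>2 \<le> c K' (y - q)\<^sup>2\<close> for \<open>K(y) = (y - q) f[p,r,y]\<close> with \<open>c = f[p,q,r]\<close>.
  A solution survives up to \<open>y = \<infinity>\<close> only if \<open>K(y) \<le> c (y - q)\<close>, that is
  \<open>f[p,r,y] \<le> f[p,q,r]\<close>. So third divided differences of \<open>f\<close> are nonpositive, and by reflection
  they vanish.\<close>

section \<open>Real symmetric 2 x 2 matrices and their explicit functional calculus\<close>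

definition sym2 :: "real \<Rightarrow> real \<Rightarrow> real \<Rightarrow> complex mat" where
  "sym2 p q r = mat 2 2 (\<lambda>(i, j). complex_of_real (if i = j then (if i = 0 then p else r) else q))"

definition rot2 :: "real \<Rightarrow> real \<Rightarrow> complex mat" where
  "rot2 c s = mat 2 2 (\<lambda>(i, j). complex_of_real (if i = j then c else if i = 0 then - s else s))"

lemma sym2_carrier [simp]: "sym2 p q r \<in> carrier_mat 2 2"
  and rot2_carrier [simp]: "rot2 c s \<in> carrier_mat 2 2"
  by (auto simp: sym2_def rot2_def)

lemma mat2_eqI:
  assumes "A \<in> carrier_mat 2 2" "B \<in> carrier_mat 2 2"
    and "A $$ (0,0) = B $$ (0,0)" "A $$ (0,1) = B $$ (0,1)"
    and "A $$ (1,0) = B $$ (1,0)" "A $$ (1,1) = B $$ (1,1)"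
  shows "A = B"
  using assms by (intro eq_matI) (auto simp: less_2_cases_iff)

lemma mult_mat2_index:
  assumes "(A :: complex mat) \<in> carrier_mat 2 2" "B \<in> carrier_mat 2 2" "i < 2" "j < 2"
  shows "(A * B) $$ (i, j) = A $$ (i, 0) * B $$ (0, j) + A $$ (i, 1) * B $$ (1, j)"
  using assms by (auto simp: scalar_prod_def numeral_2_eq_2)

lemma mat_adjoint_index:
  assumes "(A :: complex mat) \<in> carrier_mat n m" "i < m" "j < n"
  shows "mat_adjoint A $$ (i, j) = cnj (A $$ (j, i))"
  using assms by (auto simp: mat_adjoint_def mat_of_rows_def)

lemma sym2_diff: "sym2 p q r - sym2 p' q' r' = sym2 (p - p') (q - q') (r - r')"
  by (rule mat2_eqI) (auto simp: sym2_def)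

lemma sym2_add: "sym2 p q r + sym2 p' q' r' = sym2 (p + p') (q + q') (r + r')"
  by (rule mat2_eqI) (auto simp: sym2_def)

lemma sym2_smult: "complex_of_real t \<cdot>\<^sub>m sym2 p q r = sym2 (t * p) (t * q) (t * r)"
  by (rule mat2_eqI) (auto simp: sym2_def)

lemma sym2_adjoint [simp]: "mat_adjoint (sym2 p q r) = sym2 p q r"
  by (rule mat2_eqI)
    (auto intro: mat_adjoint_carrier simp: mat_adjoint_index[OF sym2_carrier], auto simp: sym2_def)

lemma hermitian_sym2: "hermitian_mat 2 (sym2 p q r)"
  by (simp add: hermitian_mat_def)

text \<open>Since the entries are real and symmetric, the mixed terms between real and imaginary
  parts of \<open>v\<close> cancel, leaving the same real form at each part.\<close>

lemma sym2_quadratic_form: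
  assumes "v \<in> carrier_vec 2"
  shows "(sym2 p q r *\<^sub>v v) \<bullet>c v =
    complex_of_real (p * (Re (v $ 0))\<^sup>2 + 2 * q * Re (v $ 0) * Re (v $ 1) + r * (Re (v $ 1))\<^sup>2
      + (p * (Im (v $ 0))\<^sup>2 + 2 * q * Im (v $ 0) * Im (v $ 1) + r * (Im (v $ 1))\<^sup>2))"
  using assms
  by (auto simp: sym2_def scalar_prod_def numeral_2_eq_2 complex_eq_iff algebra_simps power2_eq_square)

lemma psd_sym2_iff:
  "psd_mat 2 (sym2 p q r) \<longleftrightarrow> 0 \<le> p \<and> 0 \<le> r \<and> q\<^sup>2 \<le> p * r"
proof
  assume psd: "psd_mat 2 (sym2 p q r)"
  have form: "0 \<le> p * x\<^sup>2 + 2 * q * x * y + r * y\<^sup>2" for x y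
  proof -
    have "vec 2 (\<lambda>i. complex_of_real (if i = 0 then x else y)) \<in> carrier_vec 2" by simp
    with psd show ?thesis
      unfolding psd_mat_def using sym2_quadratic_form by (fastforce simp: less_eq_complex_def)
  qed
  have p: "0 \<le> p" using form[of 1 0] by simp
  have r: "0 \<le> r" using form[of 0 1] by simp
  have "q\<^sup>2 \<le> p * r"
  proof (cases "p = 0")
    case True
    have "q = 0"
    proof (rule ccontr)
      assume "q \<noteq> 0"
      \<comment> \<open>At this point the form takes the value -1.\<close>
      thus False using form[of "- (r + 1) / (2 * q)" 1] True by simp
    qed
    thus ?thesis using True by simp
  next
    case False
    \<comment> \<open>At \<open>(q, -p)\<close>, which is orthogonal to the first row
      \<open>(p, q)\<close>, the form equals \<open>p\<close> times the determinant.\<close>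
    have "0 \<le> p * (p * r - q\<^sup>2)"
      using form[of q "- p"] by (simp add: algebra_simps power2_eq_square)
    thus ?thesis using p False by (simp add: zero_le_mult_iff)
  qed
  with p r show "0 \<le> p \<and> 0 \<le> r \<and> q\<^sup>2 \<le> p * r" by simp
next
  assume h: "0 \<le> p \<and> 0 \<le> r \<and> q\<^sup>2 \<le> p * r"
  have form: "0 \<le> p * x\<^sup>2 + 2 * q * x * y + r * y\<^sup>2" for x y
  proof (cases "p = 0")
    case True
    thus ?thesis using h by simp
  next
    case False
    have "p * (p * x\<^sup>2 + 2 * q * x * y + r * y\<^sup>2) = (p * x + q * y)\<^sup>2 + (p * r - q\<^sup>2) * y\<^sup>2"
      by (simp add: algebra_simps power2_eq_square)
    also have "\<dots> \<ge> 0" using h by simp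
    finally show ?thesis using h False by (simp add: zero_le_mult_iff)
  qed
  show "psd_mat 2 (sym2 p q r)"
    unfolding psd_mat_def
  proof (intro conjI ballI hermitian_sym2)
    fix v :: "complex vec" assume "v \<in> carrier_vec 2"
    thus "0 \<le> (sym2 p q r *\<^sub>v v) \<bullet>c v"
      unfolding sym2_quadratic_form[OF \<open>v \<in> carrier_vec 2\<close>]
      using add_nonneg_nonneg[OF form form] by (simp only: less_eq_complex_def) simp
  qed
qed

text \<open>For c^2 + s^2 = 1 this matrix has eigenvector (c, s) for \<open>a\<close> and (-s, c)
  for \<open>b\<close>. Writing it as a \<open>sym2\<close> reduces order comparisons to
  \<open>psd_sym2_iff\<close>.\<close>

definition rotated_diag :: "real \<Rightarrow> real \<Rightarrow> real \<Rightarrow> real \<Rightarrow> complex mat" where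
  "rotated_diag c s a b = sym2 (a * c\<^sup>2 + b * s\<^sup>2) ((a - b) * c * s) (a * s\<^sup>2 + b * c\<^sup>2)"

lemma rot2_diag:
  "rot2 c s * mat_diag 2 (\<lambda>i. complex_of_real (if i = 0 then a else b)) * mat_adjoint (rot2 c s)
     = rotated_diag c s a b" (is "?R * ?D * ?R' = _")
proof -
  have c: "?D \<in> carrier_mat 2 2" "?R' \<in> carrier_mat 2 2" "?R * ?D \<in> carrier_mat 2 2"
    "?R * ?D * ?R' \<in> carrier_mat 2 2"
    by (auto intro!: mat_adjoint_carrier mult_carrier_mat[of _ 2 2] simp: mat_diag_def)
  show ?thesis
    by (rule mat2_eqI)
      (use c in \<open>simp_all add: mult_mat2_index mat_adjoint_index[OF rot2_carrier] rotated_diag_def\<close>,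
       simp_all add: sym2_def rot2_def mat_diag_def algebra_simps power2_eq_square)
qed

lemma spectral_decomposition_rotated_diag:
  assumes "c\<^sup>2 + s\<^sup>2 = 1"
  shows "spectral_decomposition 2 (rotated_diag c s a b) (rot2 c s) (\<lambda>i. if i = 0 then a else b)"
proof -
  let ?R = "rot2 c s" and ?R' = "mat_adjoint (rot2 c s)"
  have c: "?R' \<in> carrier_mat 2 2" by (auto intro!: mat_adjoint_carrier)
  have cs: "complex_of_real c * complex_of_real c + complex_of_real s * complex_of_real s = 1"
    using assms by (simp flip: of_real_mult of_real_add add: power2_eq_square)
  note sc = cs[unfolded add.commute[of "complex_of_real c * _"]]
  have carrier: "?R' * ?R \<in> carrier_mat 2 2" "?R * ?R' \<in> carrier_mat 2 2"
    using mult_carrier_mat[OF c rot2_carrier] mult_carrier_mat[OF rot2_carrier c] by auto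
  have "?R' * ?R = 1\<^sub>m 2"
    by (rule mat2_eqI)
      (use c carrier in \<open>simp_all add: mult_mat2_index mat_adjoint_index[OF rot2_carrier]\<close>,
       use cs sc in \<open>simp_all add: rot2_def algebra_simps\<close>)
  moreover have "?R * ?R' = 1\<^sub>m 2"
    by (rule mat2_eqI)
      (use c carrier in \<open>simp_all add: mult_mat2_index mat_adjoint_index[OF rot2_carrier]\<close>,
       use cs sc in \<open>simp_all add: rot2_def algebra_simps\<close>)
  ultimately show ?thesis
    unfolding spectral_decomposition_def unitary_mat_def rot2_diag by simp
qed

lemma mat_fun_rotated_diag:
  assumes "c\<^sup>2 + s\<^sup>2 = 1"
  shows "mat_fun 2 f (rotated_diag c s a b) = rotated_diag c s (f a) (f b)"
  using mat_fun_eqI[OF spectral_decomposition_rotated_diag[OF assms], of f a b]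
  by (simp add: if_distrib[of f] rot2_diag cong: if_cong)

text \<open>An eigenvalue is the Rayleigh quotient of its eigenvector, and the quadratic form of
  \<open>sym2\<close> is real.\<close>

lemma hermitian_mats_in_sym2: "sym2 p q r \<in> hermitian_mats_in 2 UNIV"
proof -
  have "z \<in> range complex_of_real" if "z \<in> spectrum (sym2 p q r)" for z
  proof -
    from that obtain v where v: "v \<in> carrier_vec 2" "v \<noteq> 0\<^sub>v 2"
      "sym2 p q r *\<^sub>v v = z \<cdot>\<^sub>v v"
      by (auto simp: spectrum_def eigenvalue_def eigenvector_def sym2_def)
    define n where "n = (cmod (v $ 0))\<^sup>2 + (cmod (v $ 1))\<^sup>2"
    have "v $ 0 \<noteq> 0 \<or> v $ 1 \<noteq> 0"
      using v(1,2) by (auto simp: vec_eq_iff less_2_cases_iff)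
    hence n: "n \<noteq> 0" unfolding n_def by (auto simp: add_nonneg_eq_0_iff)
    have "complex_of_real n = v $ 0 * cnj (v $ 0) + v $ 1 * cnj (v $ 1)"
      by (simp add: n_def complex_norm_square del: of_real_power)
    hence "(sym2 p q r *\<^sub>v v) \<bullet>c v = z * complex_of_real n"
      using v(1) unfolding v(3)
      by (auto simp: scalar_prod_def numeral_2_eq_2 distrib_left mult.assoc)
    then obtain k where "z * complex_of_real n = complex_of_real k"
      using sym2_quadratic_form[OF v(1)] by metis
    hence "z = complex_of_real (k / n)" using n by (simp add: field_simps)
    thus ?thesis by blast
  qed
  thus ?thesis by (auto simp: hermitian_mats_in_def hermitian_sym2)
qed

lemma mat_fun_diag:
  "mat_fun 2 f (sym2 x 0 y) = sym2 (f x) 0 (f y)"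
  using mat_fun_rotated_diag[of 1 0 f x y] by (simp add: rotated_diag_def)

section \<open>Part (a): 2-monotone functions\<close>

lemma n_monotone_2_mono:
  assumes "n_monotone 2 UNIV f"
  shows "mono f"
proof
  fix x y :: real assume "x \<le> y"
  hence "loewner_le 2 (sym2 x 0 x) (sym2 y 0 y)"
    by (simp add: loewner_le_def sym2_diff psd_sym2_iff)
  hence "loewner_le 2 (mat_fun 2 f (sym2 x 0 x)) (mat_fun 2 f (sym2 y 0 y))"
    using assms hermitian_mats_in_sym2 by (auto simp: n_monotone_def)
  thus "f x \<le> f y"
    by (simp add: mat_fun_diag loewner_le_def sym2_diff psd_sym2_iff)
qed

lemma n_monotone_2_cross_ratio:
  assumes "n_monotone 2 UNIV f" "a < x" "x < b" "b < y"
  shows "(f b - f a) * (f y - f x) * ((x - a) * (y - b)) \<le>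
         (f x - f a) * (f y - f b) * ((b - a) * (y - x))"
proof -
  \<comment> \<open>The squared sine of the rotation angle is a cross ratio. Its complement to 1 is
    (b - x)(y - a) over the same denominator, so it lies in [0, 1].\<close>
  define \<sigma> where "\<sigma> = (x - a) * (y - b) / ((b - a) * (y - x))"
  have pos: "(b - a) * (y - x) > 0" using assms by simp
  have "(b - a) * (y - x) - (x - a) * (y - b) = (b - x) * (y - a)"
    by (simp add: algebra_simps)
  also have "\<dots> > 0" using assms by simp
  finally have \<sigma>: "0 \<le> \<sigma>" "\<sigma> \<le> 1" and \<sigma>eq: "\<sigma> * ((b - a) * (y - x)) = (x - a) * (y - b)"
    using assms pos unfolding \<sigma>_def by (auto simp: divide_simps)
  define s c where "s = sqrt \<sigma>" and "c = sqrt (1 - \<sigma>)"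
  have s2: "s\<^sup>2 = \<sigma>" and c2: "c\<^sup>2 = 1 - \<sigma>" using \<sigma> by (auto simp: s_def c_def)
  have cs: "c\<^sup>2 + s\<^sup>2 = 1" by (simp add: s2 c2)
  \<comment> \<open>The determinant of \<open>diag(x, y) - A\<close> is affine in \<open>s\<^sup>2\<close>, and \<open>\<sigma>\<close> is its zero.\<close>
  have det: "(x - (a * c\<^sup>2 + b * s\<^sup>2)) * (y - (a * s\<^sup>2 + b * c\<^sup>2)) - ((a - b) * c * s)\<^sup>2
     = (x - a) * (y - b) - \<sigma> * ((b - a) * (y - x))" for a b x y
    by (simp add: s2 c2 power_mult_distrib) (simp add: algebra_simps power2_eq_square)
  let ?p = "x - (a * c\<^sup>2 + b * s\<^sup>2)" and ?r = "y - (a * s\<^sup>2 + b * c\<^sup>2)"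
  let ?q = "- ((a - b) * c * s)"
  have d0: "?q\<^sup>2 \<le> ?p * ?r" using det[where a=a and b=b and x=x and y=y] \<sigma>eq by simp
  \<comment> \<open>A nonnegative product allows two nonpositive diagonal entries; the positive
    trace excludes this.\<close>
  have "?p + ?r = (x - a) + (y - b)" unfolding s2 c2 by (simp add: algebra_simps)
  hence "?p + ?r > 0" using assms by simp
  moreover have "?p * ?r \<ge> 0" using d0 zero_le_power2[of ?q] by linarith
  ultimately have "0 \<le> ?p \<and> 0 \<le> ?r" by (auto simp: zero_le_mult_iff)
  hence "loewner_le 2 (rotated_diag c s a b) (sym2 x 0 y)"
    using d0 by (simp add: loewner_le_def rotated_diag_def sym2_diff psd_sym2_iff)
  hence "loewner_le 2 (mat_fun 2 f (rotated_diag c s a b)) (mat_fun 2 f (sym2 x 0 y))"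
    using assms hermitian_mats_in_sym2 by (auto simp: n_monotone_def rotated_diag_def)
  hence "loewner_le 2 (rotated_diag c s (f a) (f b)) (sym2 (f x) 0 (f y))"
    by (simp add: mat_fun_rotated_diag[OF cs] mat_fun_diag)
  hence "(- ((f a - f b) * c * s))\<^sup>2 \<le>
      (f x - (f a * c\<^sup>2 + f b * s\<^sup>2)) * (f y - (f a * s\<^sup>2 + f b * c\<^sup>2))"
    by (simp add: loewner_le_def rotated_diag_def sym2_diff psd_sym2_iff)
  \<comment> \<open>The identity \<open>det\<close> holds for arbitrary reals, so it also evaluates
    the determinant formed from the values of \<open>f\<close>.\<close>
  hence "\<sigma> * ((f b - f a) * (f y - f x)) \<le> (f x - f a) * (f y - f b)"
    using det[where a="f a" and b="f b" and x="f x" and y="f y"] by simp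
  from mult_right_mono[OF this less_imp_le[OF pos]]
  have "(f b - f a) * (f y - f x) * (\<sigma> * ((b - a) * (y - x))) \<le>
      (f x - f a) * (f y - f b) * ((b - a) * (y - x))"
    by (simp only: ac_simps)
  thus ?thesis unfolding \<sigma>eq .
qed

text \<open>As \<open>a\<close> tends to minus infinity, (x - a)/(b - a) tends to 1, while
  monotonicity gives f x - f a \<le> f b - f a, so the unknown value f a drops out. An explicit
  \<open>a\<close> replaces the limit.\<close>

lemma cross_ratio_imp_chord_le:
  fixes f :: "real \<Rightarrow> real"
  assumes "mono f"
    and cross: "\<And>a x b y. a < x \<Longrightarrow> x < b \<Longrightarrow> b < y \<Longrightarrow>
        (f b - f a) * (f y - f x) * ((x - a) * (y - b)) \<le>
        (f x - f a) * (f y - f b) * ((b - a) * (y - x))"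
    and "x < b" "b < y"
  shows "(f y - f x) * (y - b) \<le> (f y - f b) * (y - x)"
proof (rule ccontr)
  define X Y where "X = (f y - f b) * (y - x)" and "Y = (f y - f x) * (y - b)"
  assume "\<not> ?thesis"
  hence XY: "X < Y" by (simp add: X_def Y_def)
  \<comment> \<open>The first summand makes (Y - X)(x - a) reach X (b - x); the summand 1 makes it
    exceed that by Y - X > 0.\<close>
  define a where "a = x - (\<bar>X\<bar> * (b - x) / (Y - X) + 1)"
  have X0: "X \<ge> 0" using assms monoD[OF \<open>mono f\<close>, of b y] by (simp add: X_def)
  have "\<bar>X\<bar> * (b - x) / (Y - X) \<ge> 0" using XY \<open>x < b\<close> by simp
  hence ax: "a < x" by (simp add: a_def)
  have fa: "f a \<le> f x" "f x \<le> f b" using ax \<open>x < b\<close> monoD[OF \<open>mono f\<close>] by auto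
  show False
  proof (cases "f b = f x")
    \<comment> \<open>Here \<open>f b - f a\<close> might vanish and could not be cancelled, but the
      claim is immediate from y - b < y - x.\<close>
    case True
    hence "Y \<le> X" using assms monoD[OF \<open>mono f\<close>, of b y]
      by (auto simp: X_def Y_def intro!: mult_left_mono)
    thus False using XY by simp
  next
    case False
    hence D: "f b - f a > 0" using fa by simp
    have "(f b - f a) * (Y * (x - a)) \<le> (f x - f a) * (X * (b - a))"
      using cross[OF ax \<open>x < b\<close> \<open>b < y\<close>] by (simp add: X_def Y_def algebra_simps)
    also have "\<dots> \<le> (f b - f a) * (X * (b - a))"
      using fa X0 ax \<open>x < b\<close> by (intro mult_right_mono) auto
    finally have "Y * (x - a) \<le> X * (b - a)" using D by simp
    hence "(Y - X) * (x - a) \<le> X * (b - x)" by (simp add: algebra_simps)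
    moreover have "(Y - X) * (x - a) = X * (b - x) + (Y - X)"
      using XY X0 by (simp add: a_def field_simps)
    ultimately show False using XY by simp
  qed
qed

lemma n_monotone_2_affine:
  assumes "n_monotone 2 UNIV f"
  shows "\<exists>a b. \<forall>x. f x = a * x + b"
proof -
  \<comment> \<open>The outer minus sign keeps the reflected function increasing. Reversing the four
    points preserves the cross ratio inequality, so the chord inequality for \<open>g\<close> is the
    opposite one for \<open>f\<close>.\<close>
  define g where "g u = - f (- u)" for u
  have fm: "mono f" by (rule n_monotone_2_mono[OF assms])
  hence gm: "mono g" by (auto simp: g_def mono_def)
  have gc: "(g b - g a) * (g y - g x) * ((x - a) * (y - b)) \<le>
        (g x - g a) * (g y - g b) * ((b - a) * (y - x))"
    if "a < x" "x < b" "b < y" for a x b y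
    using n_monotone_2_cross_ratio[OF assms, of "- y" "- b" "- x" "- a"] that
    by (simp add: g_def algebra_simps)
  have eq: "(f r - f p) * (r - q) = (f r - f q) * (r - p)" if "p < q" "q < r" for p q r
  proof (rule antisym)
    show "(f r - f p) * (r - q) \<le> (f r - f q) * (r - p)"
      using cross_ratio_imp_chord_le[OF fm n_monotone_2_cross_ratio[OF assms]] that by blast
    show "(f r - f q) * (r - p) \<le> (f r - f p) * (r - q)"
      using cross_ratio_imp_chord_le[OF gm gc, of "- r" "- q" "- p"] that
      by (simp add: g_def algebra_simps)
  qed
  \<comment> \<open>Collinearity of the graph points over 0, 1 and \<open>x\<close>, in whichever
    order they lie.\<close>
  have "f x = (f 1 - f 0) * x + f 0" for x
  proof -
    consider "x < 0" | "x = 0" | "0 < x" "x < 1" | "x = 1" | "1 < x" by linarith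
    thus ?thesis
      using eq[of x 0 1] eq[of 0 x 1] eq[of 0 1 x]
      by cases (auto simp: algebra_simps)
  qed
  thus ?thesis by blast
qed

section \<open>Part (b): from 2-convexity to vanishing third divided differences\<close>

lemma n_convex_2_sym2:
  assumes "n_convex 2 UNIV f" "0 \<le> t" "t \<le> 1" "c\<^sup>2 + s\<^sup>2 = 1" "c'\<^sup>2 + s'\<^sup>2 = 1"
    and mix: "complex_of_real t \<cdot>\<^sub>m rotated_diag c s a b + complex_of_real (1 - t) \<cdot>\<^sub>m rotated_diag c' s' a' b'
      = sym2 x 0 y"
  shows "loewner_le 2 (sym2 (f x) 0 (f y))
    (complex_of_real t \<cdot>\<^sub>m rotated_diag c s (f a) (f b)
      + complex_of_real (1 - t) \<cdot>\<^sub>m rotated_diag c' s' (f a') (f b'))"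
proof -
  have "rotated_diag c s a b \<in> hermitian_mats_in 2 UNIV" "rotated_diag c' s' a' b' \<in> hermitian_mats_in 2 UNIV"
    by (simp_all add: rotated_diag_def hermitian_mats_in_sym2)
  moreover have "t \<in> {0..1}" using assms by simp
  ultimately have "loewner_le 2
      (mat_fun 2 f (complex_of_real t \<cdot>\<^sub>m rotated_diag c s a b + complex_of_real (1 - t) \<cdot>\<^sub>m rotated_diag c' s' a' b'))
      (complex_of_real t \<cdot>\<^sub>m mat_fun 2 f (rotated_diag c s a b)
        + complex_of_real (1 - t) \<cdot>\<^sub>m mat_fun 2 f (rotated_diag c' s' a' b'))"
    using assms(1) unfolding n_convex_def by blast
  \<comment> \<open>The mixture is diagonal and both summands are explicitly diagonalized, so all
    three matrix functions are known.\<close>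
  thus ?thesis by (simp only: mix mat_fun_diag mat_fun_rotated_diag[OF assms(4)] mat_fun_rotated_diag[OF assms(5)])
qed

lemma n_convex_2_scalar:
  assumes "n_convex 2 UNIV f" "0 \<le> t" "t \<le> 1"
  shows "f (t * a + (1 - t) * b) \<le> t * f a + (1 - t) * f b"
  using n_convex_2_sym2[OF assms, of 1 0 1 0 a a b b "t * a + (1 - t) * b" "t * a + (1 - t) * b"]
  by (simp add: rotated_diag_def sym2_smult sym2_add loewner_le_def sym2_diff psd_sym2_iff
      del: of_real_diff)

lemma convex_above_tangent:
  fixes f :: "real \<Rightarrow> real"
  assumes conv: "\<And>t a b. 0 \<le> t \<Longrightarrow> t \<le> 1 \<Longrightarrow> f (t * a + (1 - t) * b) \<le> t * f a + (1 - t) * f b"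
    and deriv: "(f has_real_derivative D) (at y)"
  shows "f y + D * (u - y) \<le> f u"
proof (rule ccontr)
  assume "\<not> ?thesis"
  hence neg: "f u - f y - D * (u - y) < 0" by simp
  \<comment> \<open>Chord minus function along the segment from \<open>y\<close> to
    \<open>u\<close>: it vanishes at 0 and has negative slope there if the claim fails, while
    convexity makes it nonnegative on [0, 1].\<close>
  define h where "h w = f y + w * (f u - f y) - f (y + w * (u - y))" for w
  have "(f has_real_derivative D) (at (y + 0 * (u - y)))" using deriv by simp
  hence "(h has_real_derivative f u - f y - D * (u - y)) (at 0)"
    unfolding h_def by (auto intro!: derivative_eq_intros DERIV_chain2[where f=f])
  from DERIV_neg_dec_right[OF this neg] obtain d where
    d: "d > 0" "\<And>w. 0 < w \<Longrightarrow> w < d \<Longrightarrow> h (0 + w) < h 0" by blast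
  define w where "w = min (d / 2) 1"
  have w: "0 < w" "w < d" "w \<le> 1" using \<open>d > 0\<close> by (auto simp: w_def)
  have "h w < 0" using d(2)[OF w(1,2)] by (simp add: h_def)
  moreover have "h w \<ge> 0"
    using conv[of w u y] w by (simp add: h_def algebra_simps)
  ultimately show False by simp
qed

text \<open>The matrices mixed in the proof are \<open>y I\<close> plus a multiple of the projection onto \<open>(1, m)\<close>,
  respectively \<open>(1, - \<rho> m)\<close>; \<open>\<tau>\<close> and \<open>\<rho>\<close> are balanced so that the off-diagonal entries cancel.\<close>

lemma n_convex_2_perturbed:
  assumes conv: "n_convex 2 UNIV f" and deriv: "(f has_real_derivative D) (at y)"
    and \<tau>: "0 < \<tau>" "\<tau> < 1" and bal: "\<tau> * (a - y) = (1 - \<tau>) * \<rho> * (b - y)" and "m \<noteq> 0"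
  defines "Z \<equiv> \<tau> * (1 + m\<^sup>2) + (1 - \<tau>) * (1 + \<rho>\<^sup>2 * m\<^sup>2)"
  shows "(\<tau> * (f a - f y) - (1 - \<tau>) * \<rho> * (f b - f y))\<^sup>2 \<le>
    (Z * (f y - f (y + (\<tau> * a + (1 - \<tau>) * b - y) / Z)) + \<tau> * (f a - f y) + (1 - \<tau>) * (f b - f y)) *
    (\<tau> * (f a - f y - D * (a - y)) + (1 - \<tau>) * \<rho>\<^sup>2 * (f b - f y - D * (b - y)))"
proof -
  \<comment> \<open>Squared lengths of (1, m) and (1, -\<rho> m). The weight \<open>t\<close> undoes
    these normalizations: t/A = \<tau>/Z and (1 - t)/B = (1 - \<tau>)/Z.\<close>
  define A B where "A = 1 + m\<^sup>2" and "B = 1 + \<rho>\<^sup>2 * m\<^sup>2"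
  have A: "A > 0" and B: "B > 0" unfolding A_def B_def by (simp_all add: add_pos_nonneg)
  have Z: "Z = \<tau> * A + (1 - \<tau>) * B" by (simp add: Z_def A_def B_def)
  have Z0: "Z > 0" unfolding Z using A B \<tau> by (simp add: add_pos_pos)
  define t where "t = \<tau> * A / Z"
  have t1: "1 - t = (1 - \<tau>) * B / Z" using Z0 by (simp add: t_def field_simps) (simp add: Z algebra_simps)
  have t: "0 \<le> t" "t \<le> 1"
  proof -
    show "0 \<le> t" using \<tau> A Z0 by (simp add: t_def)
    have "0 \<le> 1 - t" unfolding t1 using \<tau> B Z0 by simp
    thus "t \<le> 1" by simp
  qed
  define c s c' s' where "c = 1 / sqrt A" and "s = m / sqrt A"
    and "c' = 1 / sqrt B" and "s' = - (\<rho> * m) / sqrt B"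
  have sq: "c\<^sup>2 = 1 / A" "s\<^sup>2 = m\<^sup>2 / A" "c'\<^sup>2 = 1 / B" "s'\<^sup>2 = \<rho>\<^sup>2 * m\<^sup>2 / B"
    "k * c * s = k * m / A" "k * c' * s' = - (k * \<rho> * m / B)" for k
    using A B by (simp_all add: c_def s_def c'_def s'_def power_divide power_mult_distrib)
  have cs: "c\<^sup>2 + s\<^sup>2 = 1" "c'\<^sup>2 + s'\<^sup>2 = 1"
    unfolding sq using A B by (simp_all add: field_simps, simp_all add: A_def B_def algebra_simps)
  have R: "rotated_diag c s p q = sym2 (q + (p - q) / A) ((p - q) * m / A) (q + (p - q) * m\<^sup>2 / A)"
    for p q
    unfolding rotated_diag_def sq
    using A by (intro arg_cong3[where f=sym2]) (simp_all add: field_simps, simp_all add: A_def algebra_simps)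
  have R': "rotated_diag c' s' p q =
      sym2 (q + (p - q) / B) (- ((p - q) * \<rho> * m / B)) (q + (p - q) * (\<rho>\<^sup>2 * m\<^sup>2) / B)" for p q
    unfolding rotated_diag_def sq
    using B by (intro arg_cong3[where f=sym2]) (simp_all add: field_simps, simp_all add: B_def algebra_simps)
  have tA: "t * (q + k / A) + (1 - t) * (q + l / B) = q + (\<tau> * k + (1 - \<tau>) * l) / Z" for q k l
  proof -
    have "t * (k / A) = \<tau> * k / Z" using A by (simp add: t_def)
    moreover have "(1 - t) * (l / B) = (1 - \<tau>) * l / Z" using B by (simp add: t1)
    ultimately have "t * (k / A) + (1 - t) * (l / B) = (\<tau> * k + (1 - \<tau>) * l) / Z"
      by (simp add: add_divide_distrib)
    thus ?thesis by (simp add: algebra_simps)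
  qed
  \<comment> \<open>Stated for arbitrary \<open>p\<close>, \<open>p'\<close>, \<open>q\<close>, so
    that it serves both for the eigenvalues and for their images under \<open>f\<close>.\<close>
  have mix: "complex_of_real t \<cdot>\<^sub>m rotated_diag c s p q + complex_of_real (1 - t) \<cdot>\<^sub>m rotated_diag c' s' p' q =
      sym2 (q + (\<tau> * (p - q) + (1 - \<tau>) * (p' - q)) / Z)
        ((\<tau> * (p - q) - (1 - \<tau>) * \<rho> * (p' - q)) * m / Z)
        (q + (\<tau> * (p - q) + (1 - \<tau>) * \<rho>\<^sup>2 * (p' - q)) * m\<^sup>2 / Z)" for p p' q
  proof -
    have "t * ((p - q) * m / A) + (1 - t) * (- ((p' - q) * \<rho> * m / B)) =
        (\<tau> * ((p - q) * m) + (1 - \<tau>) * (- ((p' - q) * \<rho> * m))) / Z"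
      using tA[of 0 "(p - q) * m" "- ((p' - q) * \<rho> * m)"] by (simp only: add_0 minus_divide_left)
    also have "\<dots> = (\<tau> * (p - q) - (1 - \<tau>) * \<rho> * (p' - q)) * m / Z"
      by (intro arg_cong[where f="\<lambda>k. k / Z"]) (simp add: algebra_simps)
    finally have offdiag: "t * ((p - q) * m / A) + (1 - t) * (- ((p' - q) * \<rho> * m / B)) =
        (\<tau> * (p - q) - (1 - \<tau>) * \<rho> * (p' - q)) * m / Z" .
    have "(\<tau> * ((p - q) * m\<^sup>2) + (1 - \<tau>) * ((p' - q) * (\<rho>\<^sup>2 * m\<^sup>2))) / Z =
        (\<tau> * (p - q) + (1 - \<tau>) * \<rho>\<^sup>2 * (p' - q)) * m\<^sup>2 / Z"
      by (intro arg_cong[where f="\<lambda>k. k / Z"]) (simp add: algebra_simps)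
    thus ?thesis
      unfolding R R' sym2_smult sym2_add offdiag by (simp only: tA)
  qed
  define x0 y0 where "x0 = y + (\<tau> * (a - y) + (1 - \<tau>) * (b - y)) / Z"
    and "y0 = y + (\<tau> * (a - y) + (1 - \<tau>) * \<rho>\<^sup>2 * (b - y)) * m\<^sup>2 / Z"
  have "complex_of_real t \<cdot>\<^sub>m rotated_diag c s a y + complex_of_real (1 - t) \<cdot>\<^sub>m rotated_diag c' s' b y
      = sym2 x0 0 y0"
    unfolding mix x0_def y0_def using bal by simp
  from n_convex_2_sym2[OF conv t cs this]
  have "loewner_le 2 (sym2 (f x0) 0 (f y0))
    (sym2 (f y + (\<tau> * (f a - f y) + (1 - \<tau>) * (f b - f y)) / Z)
        ((\<tau> * (f a - f y) - (1 - \<tau>) * \<rho> * (f b - f y)) * m / Z)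
        (f y + (\<tau> * (f a - f y) + (1 - \<tau>) * \<rho>\<^sup>2 * (f b - f y)) * m\<^sup>2 / Z))"
    unfolding mix .
  moreover define N1 N2 N3 where
    "N1 = f y + (\<tau> * (f a - f y) + (1 - \<tau>) * (f b - f y)) / Z - f x0"
    and "N2 = \<tau> * (f a - f y) - (1 - \<tau>) * \<rho> * (f b - f y)"
    and "N3 = f y + (\<tau> * (f a - f y) + (1 - \<tau>) * \<rho>\<^sup>2 * (f b - f y)) * m\<^sup>2 / Z - f y0"
  ultimately have N: "0 \<le> N1" "(N2 * m / Z)\<^sup>2 \<le> N1 * N3"
    by (simp_all add: loewner_le_def sym2_diff psd_sym2_iff)
  define H where "H = \<tau> * (f a - f y - D * (a - y)) + (1 - \<tau>) * \<rho>\<^sup>2 * (f b - f y - D * (b - y))"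
  have "f y + D * (y0 - y) \<le> f y0"
    by (rule convex_above_tangent[OF n_convex_2_scalar[OF conv] deriv])
  moreover have "(\<tau> * (f a - f y) + (1 - \<tau>) * \<rho>\<^sup>2 * (f b - f y)) * m\<^sup>2 / Z - D * (y0 - y) = H * m\<^sup>2 / Z"
    using Z0 unfolding y0_def H_def by (simp add: field_simps)
  ultimately have "N3 \<le> H * m\<^sup>2 / Z" unfolding N3_def by linarith
  hence "(N2 * m / Z)\<^sup>2 \<le> N1 * (H * m\<^sup>2 / Z)"
    using N mult_left_mono by fastforce
  moreover have "(N2 * m / Z)\<^sup>2 = N2\<^sup>2 * (m\<^sup>2 / Z\<^sup>2)"
    by (simp add: power_divide power_mult_distrib)
  moreover have "N1 * (H * m\<^sup>2 / Z) = (Z * N1) * H * (m\<^sup>2 / Z\<^sup>2)"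
    using Z0 by (simp add: power2_eq_square)
  ultimately have "N2\<^sup>2 * (m\<^sup>2 / Z\<^sup>2) \<le> (Z * N1) * H * (m\<^sup>2 / Z\<^sup>2)" by simp
  moreover have "m\<^sup>2 / Z\<^sup>2 > 0" using Z0 \<open>m \<noteq> 0\<close> by simp
  ultimately have "N2\<^sup>2 \<le> (Z * N1) * H" by (rule mult_right_le_imp_le)
  moreover have "x0 = y + (\<tau> * a + (1 - \<tau>) * b - y) / Z"
    by (simp add: x0_def algebra_simps)
  moreover have "Z * N1 = Z * (f y - f x0) + \<tau> * (f a - f y) + (1 - \<tau>) * (f b - f y)"
    using Z0 by (simp add: N1_def field_simps)
  ultimately show ?thesis by (simp add: N2_def H_def)
qed

text \<open>As \<open>m\<close> tends to 0, \<open>Z\<close> tends to 1 and the upper left entry of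
  the mixture tends to \<tau> a + (1 - \<tau>) b; the bound for nonzero \<open>m\<close> passes to
  the limit by continuity of \<open>f\<close>.\<close>

lemma n_convex_2_limit:
  assumes conv: "n_convex 2 UNIV f" and deriv: "\<And>x. (f has_real_derivative f' x) (at x)"
    and \<tau>: "0 < \<tau>" "\<tau> < 1" and bal: "\<tau> * (a - y) = (1 - \<tau>) * \<rho> * (b - y)"
  shows "(\<tau> * (f a - f y) - (1 - \<tau>) * \<rho> * (f b - f y))\<^sup>2 \<le>
    (\<tau> * f a + (1 - \<tau>) * f b - f (\<tau> * a + (1 - \<tau>) * b)) *
    (\<tau> * (f a - f y - f' y * (a - y)) + (1 - \<tau>) * \<rho>\<^sup>2 * (f b - f y - f' y * (b - y)))"
    (is "?N \<le> ?E * ?H")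
proof -
  define Z where "Z m = \<tau> * (1 + m\<^sup>2) + (1 - \<tau>) * (1 + \<rho>\<^sup>2 * m\<^sup>2)" for m :: real
  define H where "H = ?H"
  define G where "G m = (Z m * (f y - f (y + (\<tau> * a + (1 - \<tau>) * b - y) / Z m))
    + \<tau> * (f a - f y) + (1 - \<tau>) * (f b - f y)) * H" for m
  have Z0: "Z 0 = 1" by (simp add: Z_def)
  have Zc: "isCont Z 0" unfolding Z_def by (intro continuous_intros)
  have "isCont (\<lambda>m. y + (\<tau> * a + (1 - \<tau>) * b - y) / Z m) 0"
    by (intro continuous_intros Zc) (simp add: Z0)
  hence "isCont (\<lambda>m. f (y + (\<tau> * a + (1 - \<tau>) * b - y) / Z m)) 0"
    by (rule isCont_o2) (rule DERIV_isCont[OF deriv])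
  hence "isCont G 0"
    unfolding G_def by (intro continuous_intros Zc)
  hence "(G \<longlongrightarrow> G 0) (at 0)" by (simp add: isCont_def)
  moreover have "G 0 = ?E * H" unfolding G_def Z0 by (simp add: algebra_simps)
  ultimately have "(G \<longlongrightarrow> ?E * H) (at 0)" by simp
  moreover have "\<forall>\<^sub>F m in at 0. ?N \<le> G m"
    unfolding eventually_at_filter
  proof (intro always_eventually allI impI)
    fix m :: real assume "m \<noteq> 0"
    show "?N \<le> G m"
      unfolding G_def Z_def H_def by (rule n_convex_2_perturbed[OF conv deriv \<tau> bal \<open>m \<noteq> 0\<close>])
  qed
  ultimately have "?N \<le> ?E * H" by (rule tendsto_lowerbound) simp
  thus ?thesis unfolding H_def .
qed

text \<open>Where \<open>K\<close> is positive, the inequality says that the derivative of c/K is at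
  most that of 1/(y - x). A solution starting above the line c (y - x) would therefore blow up at a
  finite point, but \<open>K\<close> is differentiable on the whole half-line.\<close>

lemma riccati_bound:
  fixes K K' :: "real \<Rightarrow> real"
  assumes deriv: "\<And>y. y0 \<le> y \<Longrightarrow> (K has_real_derivative K' y) (at y)"
    and ineq: "\<And>y. y0 \<le> y \<Longrightarrow> (K y)\<^sup>2 \<le> c * K' y * (y - x)\<^sup>2"
    and "x < y0" "0 \<le> c"
  shows "K y0 \<le> c * (y0 - x)"
proof (rule ccontr)
  assume "\<not> ?thesis"
  hence big: "K y0 > c * (y0 - x)" by simp
  moreover have "c * (y0 - x) \<ge> 0" using assms by simp
  ultimately have K0: "K y0 > 0" by linarith
  hence c: "c > 0" using ineq[of y0] \<open>0 \<le> c\<close> by (cases "c = 0") auto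
  have K'0: "K' y \<ge> 0" if "y0 \<le> y" for y
  proof -
    have "0 \<le> c * K' y * (y - x)\<^sup>2" using ineq[OF that] zero_le_power2[of "K y"] by linarith
    moreover have "(y - x)\<^sup>2 > 0" using that \<open>x < y0\<close> by simp
    ultimately show ?thesis using c by (simp add: zero_le_mult_iff)
  qed
  have K: "K y > 0" if "y0 \<le> y" for y
  proof -
    have "K y0 \<le> K y"
      by (rule DERIV_nonneg_imp_nondecreasing[OF that]) (use deriv K'0 in blast)
    thus ?thesis using K0 by linarith
  qed
  \<comment> \<open>By the inequality \<open>G\<close> is nonincreasing, but it is negative at \<open>y0\<close> and \<open>> - 1 / (y - x)\<close> later.\<close>
  define G where "G y = c / K y - 1 / (y - x)" for y
  have Gle: "G y \<le> G y0" if "y0 \<le> y" for y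
  proof (rule DERIV_nonpos_imp_nonincreasing[OF that])
    fix z assume z: "y0 \<le> z" "z \<le> y"
    have zx: "z - x > 0" using z \<open>x < y0\<close> by simp
    have "(G has_real_derivative - (c * K' z / (K z)\<^sup>2) + 1 / (z - x)\<^sup>2) (at z)"
      unfolding G_def using K[OF z(1)] zx
      by (auto intro!: derivative_eq_intros deriv z simp: power2_eq_square)
    moreover have "- (c * K' z / (K z)\<^sup>2) + 1 / (z - x)\<^sup>2 \<le> 0"
      using ineq[OF z(1)] K[OF z(1)] zx by (simp add: field_simps)
    ultimately show "\<exists>D. (G has_real_derivative D) (at z) \<and> D \<le> 0" by blast
  qed
  have G0: "G y0 < 0" using big K0 \<open>x < y0\<close> by (simp add: G_def field_simps)
  \<comment> \<open>Far enough that 1/(y - x) < - G y0, since y - x exceeds 1/(- G y0) by y0 -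
    x.\<close>
  define y where "y = y0 + 1 / (- G y0)"
  have y: "y0 \<le> y" "1 / (- G y0) < y - x" using G0 \<open>x < y0\<close> by (auto simp: y_def)
  have "- 1 / (y - x) < G y" using K[OF y(1)] c by (simp add: G_def)
  moreover have "- 1 / (y - x) > G y0"
    using y G0 \<open>x < y0\<close> by (simp add: field_simps)
  ultimately show False using Gle[OF y(1)] by linarith
qed

text \<open>The third divided difference, multiplied by the product of all differences of the nodes.\<close>

definition cubic_defect :: "(real \<Rightarrow> real) \<Rightarrow> real \<Rightarrow> real \<Rightarrow> real \<Rightarrow> real \<Rightarrow> real" where
  "cubic_defect f p q r s =
     f s * (r - p) * (q - p) * (r - q) - f r * (s - p) * (s - q) * (q - p)
     + f q * (s - p) * (s - r) * (r - p) - f p * (s - q) * (s - r) * (r - q)"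

text \<open>The consequences of 2-convexity are taken as hypotheses, so that the lemma also applies
  to the reflected function without showing that function to be 2-convex.\<close>

lemma cubic_defect_nonpos:
  assumes deriv: "\<And>x. (f has_real_derivative f' x) (at x)"
    and conv: "\<And>t a b. 0 \<le> t \<Longrightarrow> t \<le> 1 \<Longrightarrow> f (t * a + (1 - t) * b) \<le> t * f a + (1 - t) * f b"
    and lim: "\<And>\<tau> a b y \<rho>. 0 < \<tau> \<Longrightarrow> \<tau> < 1 \<Longrightarrow> \<tau> * (a - y) = (1 - \<tau>) * \<rho> * (b - y) \<Longrightarrow>
      (\<tau> * (f a - f y) - (1 - \<tau>) * \<rho> * (f b - f y))\<^sup>2 \<le>
      (\<tau> * f a + (1 - \<tau>) * f b - f (\<tau> * a + (1 - \<tau>) * b)) *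
      (\<tau> * (f a - f y - f' y * (a - y)) + (1 - \<tau>) * \<rho>\<^sup>2 * (f b - f y - f' y * (b - y)))"
    and "p < q" "q < r" "r < s"
  shows "cubic_defect f p q r s \<le> 0"
proof -
  note ord = \<open>p < q\<close> \<open>q < r\<close> \<open>r < s\<close>
  define \<tau> where "\<tau> = (q - p) / (r - p)"
  have \<tau>: "0 < \<tau>" "\<tau> < 1" and \<tau>1: "1 - \<tau> = (r - q) / (r - p)"
    using ord by (auto simp: \<tau>_def field_simps)
  have q: "\<tau> * r + (1 - \<tau>) * p = q"
  proof -
    have "\<tau> * (r - p) = q - p" using ord by (simp add: \<tau>_def)
    thus ?thesis by (simp add: algebra_simps)
  qed
  define E where "E = \<tau> * f r + (1 - \<tau>) * f p - f q"
  have E: "E \<ge> 0" using conv[of \<tau> r p] \<tau> by (simp add: E_def q)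
  \<comment> \<open>This is f[p,q,r], because \<tau> (1 - \<tau>) (r - p)^2 = (q - p)(r -
    q).\<close>
  define c where "c = E / (\<tau> * (1 - \<tau>)) / (r - p)\<^sup>2"
  define K where "K y = (1 - \<tau>) * ((f r - f y) / (r - y)) + \<tau> * ((f p - f y) / (p - y))
    - (f r - f p) / (r - p)" for y
  define K' where "K' y = (1 - \<tau>) * ((f r - f y - f' y * (r - y)) / (r - y)\<^sup>2)
    + \<tau> * ((f p - f y - f' y * (p - y)) / (p - y)\<^sup>2)" for y
  have K_eq: "K y = (y - q) * (((f r - f y) / (r - y) - (f p - f y) / (p - y)) / (r - p))"
    if "r < y" for y
  proof -
    define u v where "u = (f r - f y) / (r - y)" and "v = (f p - f y) / (p - y)"
    have uv: "f r - f p = u * (r - y) - v * (p - y)" using that ord by (simp add: u_def v_def)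
    have "(r - p) * K y = ((1 - \<tau>) * u + \<tau> * v) * (r - p) - (f r - f p)"
      using ord by (simp add: K_def u_def v_def field_simps)
    also have "\<dots> = (y - (\<tau> * r + (1 - \<tau>) * p)) * (u - v)"
      unfolding uv by (simp add: algebra_simps)
    finally have "(r - p) * K y = (y - q) * (u - v)" unfolding q .
    thus ?thesis using ord by (simp add: u_def v_def field_simps)
  qed
  have slope: "((\<lambda>u. (f k - f u) / (k - u)) has_real_derivative
      (f k - f y - f' y * (k - y)) / (k - y)\<^sup>2) (at y)" if "y \<noteq> k" for k y
    using that by (auto intro!: derivative_eq_intros deriv simp: power2_eq_square)
  have Kd: "(K has_real_derivative K' y) (at y)" if "s \<le> y" for y
  proof -
    have "y \<noteq> r" "y \<noteq> p" using that ord by auto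
    thus ?thesis
      unfolding K_def K'_def
      using DERIV_diff[OF DERIV_add[OF DERIV_cmult[OF slope] DERIV_cmult[OF slope]] DERIV_const]
      by simp
  qed
  have ric: "(K y)\<^sup>2 \<le> c * K' y * (y - q)\<^sup>2" if "s \<le> y" for y
  proof -
    define \<alpha> \<beta> where "\<alpha> = r - y" and "\<beta> = p - y"
    have nz: "\<alpha> \<noteq> 0" "\<beta> \<noteq> 0" using that ord by (auto simp: \<alpha>_def \<beta>_def)
    \<comment> \<open>The value forced by the balance condition of \<open>lim\<close> for the nodes
      \<open>r\<close> and \<open>p\<close>.\<close>
    define \<rho> where "\<rho> = \<tau> * \<alpha> / ((1 - \<tau>) * \<beta>)"
    define F G where "F = f r - f y" and "G = f p - f y"
    define A B where "A = F - f' y * \<alpha>" and "B = G - f' y * \<beta>"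
    have \<rho>: "(1 - \<tau>) * \<rho> = \<tau> * \<alpha> / \<beta>" using nz \<tau> by (simp add: \<rho>_def)
    have "\<tau> * \<alpha> = (1 - \<tau>) * \<rho> * \<beta>" unfolding \<rho> using nz by simp
    hence "(\<tau> * F - (1 - \<tau>) * \<rho> * G)\<^sup>2 \<le> E * (\<tau> * A + (1 - \<tau>) * \<rho>\<^sup>2 * B)"
      using lim[of \<tau> r y \<rho> p] \<tau>
      by (simp add: \<alpha>_def \<beta>_def A_def B_def F_def G_def q E_def)
    moreover have "\<tau> * F - (1 - \<tau>) * \<rho> * G = (\<tau> * \<alpha>) * (F / \<alpha> - G / \<beta>)"
      unfolding \<rho> using nz by (simp add: field_simps)
    moreover have "\<tau> * A + (1 - \<tau>) * \<rho>\<^sup>2 * B = (\<tau> * \<alpha>)\<^sup>2 * (K' y / (\<tau> * (1 - \<tau>)))"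
    proof -
      have "K' y = (1 - \<tau>) * (A / \<alpha>\<^sup>2) + \<tau> * (B / \<beta>\<^sup>2)"
        by (simp add: K'_def A_def B_def F_def G_def \<alpha>_def \<beta>_def)
      hence "K' y / (\<tau> * (1 - \<tau>)) = A / \<alpha>\<^sup>2 / \<tau> + B / \<beta>\<^sup>2 / (1 - \<tau>)"
        using \<tau> by (simp add: add_divide_distrib)
      moreover have "(1 - \<tau>) * \<rho>\<^sup>2 * B = (\<tau> * \<alpha>)\<^sup>2 * (B / \<beta>\<^sup>2 / (1 - \<tau>))"
        using \<tau> nz by (simp add: \<rho>_def power2_eq_square ac_simps)
      moreover have "\<tau> * A = (\<tau> * \<alpha>)\<^sup>2 * (A / \<alpha>\<^sup>2 / \<tau>)"
        using \<tau> nz by (simp add: power2_eq_square)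
      ultimately show ?thesis by (simp only: distrib_left)
    qed
    ultimately have "((\<tau> * \<alpha>) * (F / \<alpha> - G / \<beta>))\<^sup>2 \<le> E * ((\<tau> * \<alpha>)\<^sup>2 * (K' y / (\<tau> * (1 - \<tau>))))"
      by (simp only:)
    hence "(\<tau> * \<alpha>)\<^sup>2 * (F / \<alpha> - G / \<beta>)\<^sup>2 \<le> (\<tau> * \<alpha>)\<^sup>2 * (E * (K' y / (\<tau> * (1 - \<tau>))))"
      by (simp only: power_mult_distrib[of "\<tau> * \<alpha>"] mult.left_commute[of E])
    moreover have "(\<tau> * \<alpha>)\<^sup>2 > 0" using nz \<tau> by simp
    ultimately have "(F / \<alpha> - G / \<beta>)\<^sup>2 \<le> E / (\<tau> * (1 - \<tau>)) * K' y"
      by (simp only: mult_le_cancel_left_pos) simp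
    hence "(F / \<alpha> - G / \<beta>)\<^sup>2 * ((y - q)\<^sup>2 / (r - p)\<^sup>2) \<le>
        E / (\<tau> * (1 - \<tau>)) * K' y * ((y - q)\<^sup>2 / (r - p)\<^sup>2)"
      by (rule mult_right_mono) simp
    thus ?thesis
      using that ord
      by (simp add: K_eq c_def F_def G_def \<alpha>_def \<beta>_def power_mult_distrib power_divide mult.commute)
  qed
  have "K s \<le> c * (s - q)"
    by (rule riccati_bound[OF Kd ric]) (use ord \<tau> E in \<open>auto simp: c_def\<close>)
  moreover define u v where "u = (f r - f s) / (r - s)" and "v = (f p - f s) / (p - s)"
  ultimately have "(s - q) * ((u - v) / (r - p)) \<le> (s - q) * c"
    using K_eq[OF \<open>r < s\<close>] by (simp only: mult.commute[of c])
  hence "(u - v) / (r - p) \<le> c" by (rule mult_left_le_imp_le) (use ord in simp)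
  hence uv: "u - v \<le> c * (r - p)" using ord by (simp add: pos_divide_le_eq)
  have "\<tau> * (1 - \<tau>) * (r - p)\<^sup>2 = (q - p) * (r - q)"
    using ord unfolding \<tau>1 by (simp add: \<tau>_def power2_eq_square)
  hence "c = E / ((q - p) * (r - q))" by (simp add: c_def)
  hence cE: "c * ((q - p) * (r - q)) = E" using ord by simp
  have "\<tau> * (r - p) = q - p" "(1 - \<tau>) * (r - p) = r - q"
    using ord unfolding \<tau>1 by (simp_all add: \<tau>_def)
  moreover have "E * (r - p) = \<tau> * (r - p) * f r + (1 - \<tau>) * (r - p) * f p - (r - p) * f q"
    unfolding E_def by (simp add: algebra_simps)
  ultimately have E_eq: "E * (r - p) = (q - p) * f r + (r - q) * f p - (r - p) * f q" by simp
  have us: "u * (s - r) = f s - f r" and vs: "v * (s - p) = f s - f p"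
    using ord by (simp_all add: u_def v_def field_simps)
  \<comment> \<open>The bound f[p,r,s] \<le> f[p,q,r] is multiplied by all the positive node
    differences except s - q, which was already cancelled.\<close>
  have "((f s - f r) * (s - p) - (f s - f p) * (s - r)) * ((q - p) * (r - q)) =
      (u - v) * ((s - r) * (s - p) * ((q - p) * (r - q)))"
    unfolding us[symmetric] vs[symmetric] by (simp add: algebra_simps)
  also have "\<dots> \<le> c * (r - p) * ((s - r) * (s - p) * ((q - p) * (r - q)))"
    using uv ord by (intro mult_right_mono) auto
  also have "\<dots> = c * ((q - p) * (r - q)) * (r - p) * ((s - r) * (s - p))"
    by (simp only: ac_simps)
  also have "\<dots> = ((q - p) * f r + (r - q) * f p - (r - p) * f q) * ((s - r) * (s - p))"
    unfolding cE E_eq ..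
  finally show ?thesis by (simp add: cubic_defect_def algebra_simps)
qed

lemma n_convex_2_quadratic:
  assumes convex: "n_convex 2 UNIV f" and deriv: "\<And>x. (f has_real_derivative f' x) (at x)"
  shows "\<exists>p :: real poly. degree p \<le> 2 \<and> (\<forall>x. f x = poly p x)"
proof -
  \<comment> \<open>Reflection preserves convexity and the limit inequality, but reversing the four
    nodes changes the sign of \<open>cubic_defect\<close>.\<close>
  define g g' where "g u = f (- u)" and "g' u = - f' (- u)" for u
  have gd: "(g has_real_derivative g' x) (at x)" for x
    unfolding g_def g'_def using deriv DERIV_mirror by blast
  have gconv: "g (t * a + (1 - t) * b) \<le> t * g a + (1 - t) * g b" if "0 \<le> t" "t \<le> 1" for t a b
    using n_convex_2_scalar[OF convex that, of "- a" "- b"] by (simp add: g_def algebra_simps)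
  have glim: "(\<tau> * (g a - g y) - (1 - \<tau>) * \<rho> * (g b - g y))\<^sup>2 \<le>
      (\<tau> * g a + (1 - \<tau>) * g b - g (\<tau> * a + (1 - \<tau>) * b)) *
      (\<tau> * (g a - g y - g' y * (a - y)) + (1 - \<tau>) * \<rho>\<^sup>2 * (g b - g y - g' y * (b - y)))"
    if "0 < \<tau>" "\<tau> < 1" and bal: "\<tau> * (a - y) = (1 - \<tau>) * \<rho> * (b - y)" for \<tau> a b y \<rho>
  proof -
    have "\<tau> * (- a - - y) = - (\<tau> * (a - y))" by (simp add: algebra_simps)
    also have "\<dots> = (1 - \<tau>) * \<rho> * (- b - - y)" unfolding bal by (simp add: algebra_simps)
    finally have bal': "\<tau> * (- a - - y) = (1 - \<tau>) * \<rho> * (- b - - y)" .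
    have "\<tau> * - a + (1 - \<tau>) * - b = - (\<tau> * a + (1 - \<tau>) * b)"
      "f' (- y) * (- a - - y) = g' y * (a - y)" "f' (- y) * (- b - - y) = g' y * (b - y)"
      by (simp_all add: g'_def algebra_simps)
    with n_convex_2_limit[OF convex deriv that(1,2) bal'] show ?thesis
      by (simp only: g_def)
  qed
  have zero: "cubic_defect f p q r s = 0" if "p < q" "q < r" "r < s" for p q r s
  proof (rule antisym)
    show "cubic_defect f p q r s \<le> 0"
      by (rule cubic_defect_nonpos[where f' = f'], rule deriv,
          rule n_convex_2_scalar[OF convex], assumption+,
          rule n_convex_2_limit[OF convex deriv], assumption+) (use that in simp_all)
    have "cubic_defect g (- s) (- r) (- q) (- p) \<le> 0"
      by (rule cubic_defect_nonpos[where f' = g'], rule gd, rule gconv, assumption+,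
          rule glim, assumption+) (use that in simp_all)
    moreover have "cubic_defect g (- s) (- r) (- q) (- p) = - cubic_defect f p q r s"
      by (simp add: cubic_defect_def g_def algebra_simps)
    ultimately show "0 \<le> cubic_defect f p q r s" by simp
  qed
  \<comment> \<open>The interpolation polynomial at -1, 0 and 1; a vanishing
    \<open>cubic_defect\<close> at these nodes and \<open>x\<close> puts f x on it.\<close>
  have "f x = poly [:f 0, (f 1 - f (-1)) / 2, (f 1 + f (-1) - 2 * f 0) / 2:] x" for x
  proof -
    consider "x < -1" | "x = -1" | "-1 < x" "x < 0" | "x = 0" | "0 < x" "x < 1" | "x = 1" | "1 < x"
      by linarith
    thus ?thesis
      using zero[of x "-1" 0 1] zero[of "-1" x 0 1] zero[of "-1" 0 x 1] zero[of "-1" 0 1 x]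
      by cases (auto simp: cubic_defect_def field_simps)
  qed
  moreover have "degree [:f 0, (f 1 - f (-1)) / 2, (f 1 + f (-1) - 2 * f 0) / 2:] \<le> 2"
    by simp
  ultimately show ?thesis by blast
qed

theorem theorem3p5:
  fixes f :: "real \<Rightarrow> real"
  shows "(n_monotone 2 UNIV f \<and> times_cont_differentiable 3 f \<longrightarrow>
            (\<exists>a b. \<forall>x. f x = a * x + b)) \<and>
         (n_convex 2 UNIV f \<and> times_cont_differentiable 4 f \<longrightarrow>
            (\<exists>p :: real poly. degree p \<le> 2 \<and> (\<forall>x. f x = poly p x)))"
proof (intro conjI impI)
  assume "n_monotone 2 UNIV f \<and> times_cont_differentiable 3 f"
  thus "\<exists>a b. \<forall>x. f x = a * x + b" using n_monotone_2_affine by blast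
next
  assume h: "n_convex 2 UNIV f \<and> times_cont_differentiable 4 f"
  then obtain D :: "nat \<Rightarrow> real \<Rightarrow> real" where
    "D 0 = f" "\<And>j x. j < 4 \<Longrightarrow> (D j has_real_derivative D (Suc j) x) (at x)"
    unfolding times_cont_differentiable_def by blast
  hence "(f has_real_derivative D 1 x) (at x)" for x
    by (metis One_nat_def zero_less_numeral)
  thus "\<exists>p :: real poly. degree p \<le> 2 \<and> (\<forall>x. f x = poly p x)"
    using n_convex_2_quadratic h by blast
qed

end
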